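(* Consider the inconsistent-read asynchronous iteration defined in the context with step size $0\le\beta<1$, an arbitrary deterministic starting vector $x_0$, a nonnegative integer $\tau$, and deterministic sets $K(j)$ satisfying $\{i\in\mathbb{Z}:0\le i\le j-\tau-1\}\subseteq K(j)\subseteq\{0,\dots,j-1\}$. Let $\rho_2=\max_l\frac1n\sum_{r=1}^nA_{lr}^2$ and $\omega_\tau(\beta)=2\beta(1-\beta-\rho_2\tau^2\beta/2)$, and suppose $\omega_\tau(\beta)>0$. Then: (a) For every integer $m\ge \frac{\log(1/2)}{\log(1-\lambda_{\max}/n)}$, \[E_m\le\Big(1-\frac{\omega_\tau(\beta)}{2\kappa}\Big)E_0.\] (b) Let $T_0=\big\lceil \frac{\log(1/2)}{\log(1-\lambda_{\max}/n)}\big\rceil$, $T=T_0+\tau$, and \[\psi(\beta)=\frac{\rho_2\tau^3\beta^2\lambda_{\max}(1-\lambda_{\max}/n)^{-2\tau}}{n}.\] Then for every integer $r\ge1$ and every $m\ge rT$, \[E_m\le\Big(1-\frac{\omega_\tau(\beta)}{2\kappa}\Big)\Big(1-\frac{\omega_\tau(\beta)(1-\lambda_{\max}/n)^{\tau}}{2\kappa}+\psi(\beta)\Big)^{r-1}E_0.\]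
   Context: Let $n\ge2$ and let $A\in\mathbb{R}^{n\times n}$ be symmetric positive definite with all diagonal entries equal to $1$; let $b\in\mathbb{R}^n$ and $x^\star=A^{-1}b$. Let $\lambda_{\min},\lambda_{\max}$ be the smallest and largest eigenvalues of $A$ and $\kappa=\lambda_{\max}/\lambda_{\min}$. Write $(x,y)_A=y^TAx$ and $\|x\|_A=\sqrt{(x,x)_A}$; $e^{(1)},\dots,e^{(n)}$ are the standard basis vectors. Inconsistent-read iteration: let $d_0,d_1,\dots$ be i.i.d. random vectors, each uniformly distributed on $\{e^{(1)},\dots,e^{(n)}\}$; let $\tau\ge0$ be an integer and $K(0),K(1),\dots$ deterministic sets (not depending on the $d_j$) with $\{i:0\le i\le j-\tau-1\}\subseteq K(j)\subseteq\{0,\dots,j-1\}$; given $x_0\in\mathbb{R}^n$ and a step size $\beta$, define recursively for $j\ge0$ \[x_{K(j)}=x_0+\sum_{i\in K(j)}\beta\gamma_id_i,\qquad \gamma_j=(x^\star-x_{K(j)},d_j)_A,\qquad x_{j+1}=x_j+\beta\gamma_jd_j.\] Define $E_m=\mathbb{E}[\|x_m-x^\star\|_A^2]$. *)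

theory Defs
  imports "HOL-Probability.Probability"
begin

definition A_inner :: "real^'n^'n \<Rightarrow> real^'n \<Rightarrow> real^'n \<Rightarrow> real" where
  "A_inner A x y = y \<bullet> (A *v x)"

definition A_norm :: "real^'n^'n \<Rightarrow> real^'n \<Rightarrow> real" where
  "A_norm A x = sqrt (A_inner A x x)"

definition ebasis :: "'n::finite \<Rightarrow> real^'n" where
  "ebasis i = axis i 1"

definition eigenvalues :: "real^'n^'n \<Rightarrow> real set" where
  "eigenvalues A = {c. \<exists>v. v \<noteq> 0 \<and> A *v v = c *\<^sub>R v}"

definition lambda_max :: "real^'n^'n \<Rightarrow> real" where
  "lambda_max A = Max (eigenvalues A)"

definition lambda_min :: "real^'n^'n \<Rightarrow> real" where
  "lambda_min A = Min (eigenvalues A)"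

definition cond_num :: "real^'n^'n \<Rightarrow> real" where
  "cond_num A = lambda_max A / lambda_min A"

definition rho2 :: "real^'n^'n \<Rightarrow> real" where
  "rho2 A = Max (range (\<lambda>l. (1 / real CARD('n)) * (\<Sum>r\<in>UNIV. (A $ l $ r)\<^sup>2)))"

definition xstar :: "real^'n^'n \<Rightarrow> real^'n \<Rightarrow> real^'n" where
  "xstar A b = matrix_inv A *v b"

text \<open>The list [gamma_0, ..., gamma_{m-1}] of the inconsistent-read iteration, for a
  direction-index sequence d (the direction at step j is e^(d j)).\<close>
primrec gammas ::
  "real^'n^'n \<Rightarrow> real^'n \<Rightarrow> real^'n \<Rightarrow> real \<Rightarrow> (nat \<Rightarrow> nat set) \<Rightarrow> (nat \<Rightarrow> 'n::finite) \<Rightarrow> nat \<Rightarrow> real list"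
where
  "gammas A b x0 \<beta> K d 0 = []"
| "gammas A b x0 \<beta> K d (Suc j) =
     (let g = gammas A b x0 \<beta> K d j;
          xK = x0 + (\<Sum>i\<in>K j. (\<beta> * g ! i) *\<^sub>R ebasis (d i))
      in g @ [A_inner A (xstar A b - xK) (ebasis (d j))])"

definition iterate ::
  "real^'n^'n \<Rightarrow> real^'n \<Rightarrow> real^'n \<Rightarrow> real \<Rightarrow> (nat \<Rightarrow> nat set) \<Rightarrow> (nat \<Rightarrow> 'n::finite) \<Rightarrow> nat \<Rightarrow> real^'n"
where
  "iterate A b x0 \<beta> K d m =
     x0 + (\<Sum>i<m. (\<beta> * gammas A b x0 \<beta> K d m ! i) *\<^sub>R ebasis (d i))"

text \<open>E_m = E ||x_m - x*||_A^2, where d_0,...,d_{m-1} are i.i.d. uniform on the basis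
  (equivalently, the index sequence is uniform on 'n^m).\<close>
definition err_exp ::
  "real^'n^'n \<Rightarrow> real^'n \<Rightarrow> real^'n \<Rightarrow> real \<Rightarrow> (nat \<Rightarrow> nat set) \<Rightarrow> nat \<Rightarrow> real"
where
  "err_exp A b x0 \<beta> K m =
     measure_pmf.expectation (pmf_of_set (PiE {..<m} (\<lambda>_. (UNIV :: 'n::finite set))))
       (\<lambda>d. (A_norm A (iterate A b x0 \<beta> K d m - xstar A b))\<^sup>2)"

end

theory Submission
  imports Defs
begin

text \<open>For a set S of past steps let \<open>e_S\<close> be the error vector after applying only the
  updates in S, and let \<open>V S\<close> be its expected squared A-norm. Two one-step estimates drive the
  proof. A step along a direction independent of the past shrinks \<open>V\<close> by at most the factor
  \<open>q = 1 - \<lambda>_max / n\<close>, whatever its length. Conversely, by Cauchy-Schwarz on the at most \<open>\<tau>\<close> updates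
  missing from a stale read, adding step l lowers \<open>V\<close> by \<open>2 \<beta> (1 - \<beta>) E[\<gamma>_l\<^sup>2]\<close> up to
  \<open>\<beta>\<^sup>2 \<tau> \<rho>\<^sub>2\<close> times the sum of the last \<open>\<tau>\<close> values \<open>E[\<gamma>_i\<^sup>2]\<close>. Summing the second
  estimate gives \<open>E_m \<le> E_0 - \<omega> \<Sum> E[\<gamma>_j\<^sup>2]\<close>, and the first bounds the sum from below by a
  geometric series; this is (a). For (b) the same is done from a start s, where the \<open>\<tau>\<close> steps
  before s contribute an extra term. If the claimed factor is at least 1, (a) suffices. Otherwise
  \<open>\<psi> \<le> 1/4\<close>, and applying the second estimate along a read set that is not a prefix bounds its
  error by \<open>4/3\<close> of that of the prefix it contains, which is enough to make the extra term at most
  \<open>\<psi> E_s\<close>.\<close>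

section \<open>Spectral facts for real symmetric matrices\<close>

lemma sym_matrix_inner:
  fixes A :: "real^'n^'n"
  assumes "transpose A = A"
  shows "x \<bullet> (A *v y) = y \<bullet> (A *v x)"
  by (metis assms dot_lmul_matrix inner_commute transpose_matrix_vector)

text \<open>Moving from \<open>v\<close> by \<open>t\<close> times \<open>w = B *v v\<close> changes
  the form by \<open>2 * t * (w \<bullet> w)\<close> to first order, so a small negative
  \<open>t\<close> would make it negative unless \<open>w = 0\<close>.\<close>

lemma psd_kernel:
  fixes B :: "real^'n^'n"
  assumes sym: "transpose B = B" and psd: "\<And>x. 0 \<le> x \<bullet> (B *v x)" and v: "v \<bullet> (B *v v) = 0"
  shows "B *v v = 0"
proof -
  define w where "w = B *v v"
  define p where "p = w \<bullet> (B *v w)"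
  have quad: "0 \<le> 2 * t * (w \<bullet> w) + t\<^sup>2 * p" for t :: real
  proof -
    have "0 \<le> (v + t *\<^sub>R w) \<bullet> (B *v (v + t *\<^sub>R w))"
      by (rule psd)
    also have "\<dots> = v \<bullet> (B *v v) + t * (v \<bullet> (B *v w)) + t * (w \<bullet> (B *v v)) + t\<^sup>2 * p"
      by (simp add: p_def matrix_vector_right_distrib matrix_vector_mult_scaleR inner_add_left
          inner_add_right algebra_simps power2_eq_square)
    also have "v \<bullet> (B *v w) = w \<bullet> w"
      unfolding w_def by (rule sym_matrix_inner[OF sym])
    finally show ?thesis using v by (simp add: w_def)
  qed
  have p: "0 \<le> p" unfolding p_def by (rule psd)
  show ?thesis
  proof (rule ccontr)
    assume "B *v v \<noteq> 0"
    then have pos: "0 < w \<bullet> w" by (simp add: w_def)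
    \<comment> \<open>The \<open>+ 1\<close> keeps the denominator positive even if
      \<open>p = 0\<close>.\<close>
    define t where "t = - (w \<bullet> w) / (p + 1)"
    have "2 * t * (w \<bullet> w) + t\<^sup>2 * p = - (w \<bullet> w)\<^sup>2 * (p + 2) / (p + 1)\<^sup>2"
      using p unfolding t_def by (simp add: divide_simps) (simp add: power2_eq_square algebra_simps)
    also have "\<dots> < 0"
      using pos p by (simp add: divide_neg_pos mult_neg_pos)
    finally show False using quad[of t] by simp
  qed
qed

text \<open>The Rayleigh quotient attains its minimum \<open>\<mu>\<close> on the compact unit
  sphere, at some \<open>v\<close>. Then \<open>A - \<mu> I\<close> is positive semidefinite and its
  form vanishes at \<open>v\<close>, so \<open>psd_kernel\<close> makes \<open>v\<close> an
  eigenvector.\<close>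

lemma ex_least_eigenvalue:
  fixes A :: "real^'n^'n"
  assumes sym: "transpose A = A"
  obtains \<mu> where "\<mu> \<in> eigenvalues A" "\<And>x. \<mu> * (x \<bullet> x) \<le> x \<bullet> (A *v x)"
proof -
  have "continuous_on (sphere 0 1) (\<lambda>x. x \<bullet> (A *v x))"
    by (intro continuous_intros linear_continuous_on matrix_vector_mul_bounded_linear)
  moreover have "sphere (0::real^'n) 1 \<noteq> {}" by simp
  ultimately have "\<exists>v\<in>sphere 0 1. \<forall>y\<in>sphere 0 1. v \<bullet> (A *v v) \<le> y \<bullet> (A *v y)"
    by (intro continuous_attains_inf compact_sphere)
  then obtain v where v: "norm v = 1"
    and min: "\<And>y. norm y = 1 \<Longrightarrow> v \<bullet> (A *v v) \<le> y \<bullet> (A *v y)"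
    by auto
  define \<mu> where "\<mu> = v \<bullet> (A *v v)"
  have le: "\<mu> * (x \<bullet> x) \<le> x \<bullet> (A *v x)" for x
  proof (cases "x = 0")
    case False
    then have "\<mu> \<le> (x /\<^sub>R norm x) \<bullet> (A *v (x /\<^sub>R norm x))"
      unfolding \<mu>_def by (intro min) simp
    also have "\<dots> = (x \<bullet> (A *v x)) / (x \<bullet> x)"
      by (simp add: matrix_vector_mult_scaleR divide_simps dot_square_norm power2_eq_square)
    finally show ?thesis using False by (simp add: divide_simps)
  qed simp
  define B where "B = A - \<mu> *\<^sub>R mat 1"
  have B: "B *v x = A *v x - \<mu> *\<^sub>R x" for x
    by (simp add: B_def matrix_vector_mult_diff_rdistrib scaleR_matrix_vector_assoc[symmetric])
  have "B *v v = 0"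
  proof (rule psd_kernel)
    show "transpose B = B"
      using sym by (auto simp: B_def transpose_def mat_def vec_eq_iff)
    show "0 \<le> x \<bullet> (B *v x)" for x
      using le[of x] by (simp add: B inner_diff_right)
    show "v \<bullet> (B *v v) = 0"
      using v by (simp add: B inner_diff_right \<mu>_def norm_eq_1)
  qed
  then have "A *v v = \<mu> *\<^sub>R v" "v \<noteq> 0" using v by (auto simp: B)
  then have "\<mu> \<in> eigenvalues A" by (auto simp: eigenvalues_def)
  then show ?thesis using le that by blast
qed

lemma eigenvalues_uminus: "c \<in> eigenvalues (- A) \<longleftrightarrow> - c \<in> eigenvalues (A :: real^'n^'n)"
proof -
  have "(- A) *v v = - (A *v v)" for v
    by (simp add: vec_eq_iff matrix_vector_mult_def sum_negf)
  then show ?thesis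
    unfolding eigenvalues_def by (auto simp: minus_equation_iff[of "A *v _"])
qed

lemma ex_greatest_eigenvalue:
  fixes A :: "real^'n^'n"
  assumes sym: "transpose A = A"
  obtains \<mu> where "\<mu> \<in> eigenvalues A" "\<And>x. x \<bullet> (A *v x) \<le> \<mu> * (x \<bullet> x)"
proof -
  have "transpose (- A) = - A"
    using sym by (simp add: transpose_def vec_eq_iff)
  then obtain \<mu> where \<mu>: "\<mu> \<in> eigenvalues (- A)" "\<And>x. \<mu> * (x \<bullet> x) \<le> x \<bullet> ((- A) *v x)"
    using ex_least_eigenvalue by metis
  have "(- A) *v v = - (A *v v)" for v
    by (simp add: vec_eq_iff matrix_vector_mult_def sum_negf)
  with \<mu> that[of "- \<mu>"] show ?thesis
    by (simp add: eigenvalues_uminus le_minus_iff)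
qed

text \<open>Eigenvectors of distinct eigenvalues are orthogonal, hence independent. Finiteness gives
  \<open>Max\<close> and \<open>Min\<close> in \<open>lambda_max\<close> and
  \<open>lambda_min\<close> their intended meaning.\<close>

lemma finite_eigenvalues_sym:
  fixes A :: "real^'n^'n"
  assumes sym: "transpose A = A"
  shows "finite (eigenvalues A)"
proof -
  obtain v where v: "\<And>c. c \<in> eigenvalues A \<Longrightarrow> v c \<noteq> 0 \<and> A *v v c = c *\<^sub>R v c"
    unfolding eigenvalues_def by atomize_elim (rule choice, auto)
  have orth: "v c \<bullet> v c' = 0" if "c \<in> eigenvalues A" "c' \<in> eigenvalues A" "c \<noteq> c'" for c c'
  proof -
    have "c * (v c' \<bullet> v c) = c' * (v c \<bullet> v c')"
      using sym_matrix_inner[OF sym, of "v c'" "v c"] v that by simp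
    then show ?thesis using that by (simp add: inner_commute)
  qed
  have inj: "inj_on v (eigenvalues A)"
    using orth v by (intro inj_onI) (metis inner_eq_zero_iff)
  have "pairwise orthogonal (v ` eigenvalues A)"
    using orth by (auto simp: pairwise_def orthogonal_def)
  then have "independent (v ` eigenvalues A)"
    by (rule pairwise_orthogonal_independent) (use v in auto)
  then show ?thesis
    using inj finite_imageD independent_imp_finite by blast
qed

section \<open>Rayleigh bounds and entry bounds for positive definite matrices with unit
  diagonal\<close>

locale unit_spd_matrix =
  fixes A :: "real^'n^'n"
  assumes n2: "CARD('n) \<ge> 2"
    and sym: "transpose A = A"
    and posdef: "\<And>x. x \<noteq> 0 \<Longrightarrow> x \<bullet> (A *v x) > 0"
    and diag: "\<And>i. A $ i $ i = 1"
begin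

lemma psd: "0 \<le> x \<bullet> (A *v x)"
  using posdef[of x] by (cases "x = 0") auto

lemma eigenvalues_nonempty: "eigenvalues A \<noteq> {}"
  using ex_least_eigenvalue[OF sym] by blast

lemma rayleigh_le: "x \<bullet> (A *v x) \<le> lambda_max A * (x \<bullet> x)"
proof -
  obtain \<mu> where \<mu>: "\<mu> \<in> eigenvalues A" "\<And>x. x \<bullet> (A *v x) \<le> \<mu> * (x \<bullet> x)"
    using ex_greatest_eigenvalue[OF sym] by metis
  have "\<mu> \<le> lambda_max A"
    unfolding lambda_max_def using \<mu>(1) finite_eigenvalues_sym[OF sym] by simp
  then show ?thesis
    by (meson \<mu>(2) inner_ge_zero mult_right_mono order_trans)
qed

lemma rayleigh_ge: "lambda_min A * (x \<bullet> x) \<le> x \<bullet> (A *v x)"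
proof -
  obtain \<mu> where \<mu>: "\<mu> \<in> eigenvalues A" "\<And>x. \<mu> * (x \<bullet> x) \<le> x \<bullet> (A *v x)"
    using ex_least_eigenvalue[OF sym] by metis
  have "lambda_min A \<le> \<mu>"
    unfolding lambda_min_def using \<mu>(1) finite_eigenvalues_sym[OF sym] by simp
  then show ?thesis
    by (meson \<mu>(2) inner_ge_zero mult_right_mono order_trans)
qed

lemma lambda_min_pos: "0 < lambda_min A"
proof -
  have "lambda_min A \<in> eigenvalues A"
    unfolding lambda_min_def by (intro Min_in finite_eigenvalues_sym sym eigenvalues_nonempty)
  then obtain v where "v \<noteq> 0" "A *v v = lambda_min A *\<^sub>R v"
    unfolding eigenvalues_def by auto
  with posdef[of v] have "0 < lambda_min A * (v \<bullet> v)" by simp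
  then show ?thesis
    using inner_ge_zero[of v] by (auto simp: zero_less_mult_iff not_less[symmetric] simp del: inner_ge_zero)
qed

lemma lambda_min_le_max: "lambda_min A \<le> lambda_max A"
  unfolding lambda_min_def lambda_max_def
  by (meson Max_ge Min_le Min_in eigenvalues_nonempty finite_eigenvalues_sym sym)

lemma cond_num_ge_1: "1 \<le> cond_num A"
  using lambda_min_pos lambda_min_le_max by (simp add: cond_num_def)

lemma A_cauchy_schwarz: "(x \<bullet> (A *v y))\<^sup>2 \<le> (x \<bullet> (A *v x)) * (y \<bullet> (A *v y))"
proof (cases "y = 0")
  case False
  define p where "p = y \<bullet> (A *v y)"
  define s where "s = x \<bullet> (A *v y)"
  have p: "0 < p" unfolding p_def by (rule posdef[OF False])
  \<comment> \<open>The multiple \<open>s / p\<close> minimises the A-norm of \<open>x - t y\<close>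
    over \<open>t\<close>.\<close>
  have "0 \<le> (x - (s / p) *\<^sub>R y) \<bullet> (A *v (x - (s / p) *\<^sub>R y))"
    by (rule psd)
  also have "\<dots> = x \<bullet> (A *v x) - 2 * (s / p) * s + (s / p)\<^sup>2 * p"
    using sym_matrix_inner[OF sym, of x y]
    by (simp add: s_def p_def matrix_vector_mult_diff_distrib matrix_vector_mult_scaleR
        inner_diff_left inner_diff_right algebra_simps power2_eq_square)
  also have "\<dots> = x \<bullet> (A *v x) - s\<^sup>2 / p"
    using p by (simp add: field_simps power2_eq_square)
  finally show ?thesis
    using p by (simp add: field_simps flip: s_def p_def)
qed simp

text \<open>Cauchy-Schwarz in the A-form for \<open>A *v x\<close> and \<open>x\<close>, followed by
  the Rayleigh bound at \<open>A *v x\<close>, replaces a diagonalisation of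
  \<open>A\<close>.\<close>

lemma norm_image_le: "(A *v x) \<bullet> (A *v x) \<le> lambda_max A * (x \<bullet> (A *v x))"
proof (cases "A *v x = 0")
  case False
  define w where "w = A *v x"
  have "(w \<bullet> w)\<^sup>2 \<le> (w \<bullet> (A *v w)) * (x \<bullet> (A *v x))"
    using A_cauchy_schwarz[of w x] by (simp add: w_def)
  also have "\<dots> \<le> (lambda_max A * (w \<bullet> w)) * (x \<bullet> (A *v x))"
    by (intro mult_right_mono rayleigh_le psd)
  finally have "(w \<bullet> w) * (w \<bullet> w) \<le> (w \<bullet> w) * (lambda_max A * (x \<bullet> (A *v x)))"
    by (simp add: power2_eq_square mult_ac)
  moreover have "0 < w \<bullet> w" using False by (simp add: w_def)
  ultimately show ?thesis unfolding w_def by (simp only: mult_le_cancel_left_pos)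
qed simp

text \<open>Here the Euclidean Cauchy-Schwarz inequality for \<open>x\<close> and
  \<open>A *v x\<close> is combined with the Rayleigh bound at \<open>x\<close>.\<close>

lemma norm_image_ge: "lambda_min A * (x \<bullet> (A *v x)) \<le> (A *v x) \<bullet> (A *v x)"
proof (cases "x = 0")
  case False
  define w where "w = A *v x"
  have pos: "0 < x \<bullet> w" unfolding w_def by (rule posdef[OF False])
  have "lambda_min A * (x \<bullet> w)\<^sup>2 \<le> lambda_min A * ((x \<bullet> x) * (w \<bullet> w))"
    using lambda_min_pos by (intro mult_left_mono Cauchy_Schwarz_ineq) simp
  also have "\<dots> = (lambda_min A * (x \<bullet> x)) * (w \<bullet> w)" by simp
  also have "\<dots> \<le> (x \<bullet> w) * (w \<bullet> w)"
    unfolding w_def by (intro mult_right_mono rayleigh_ge) simp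
  finally have "(x \<bullet> w) * (lambda_min A * (x \<bullet> w)) \<le> (x \<bullet> w) * (w \<bullet> w)"
    by (simp add: power2_eq_square mult_ac)
  with pos show ?thesis unfolding w_def by (simp only: mult_le_cancel_left_pos)
qed simp

lemma entry_sq_less_1:
  assumes "i \<noteq> j"
  shows "(A $ i $ j)\<^sup>2 < 1"
proof -
  \<comment> \<open>The residual of projecting one basis vector A-orthogonally onto the other; its
    form equals \<open>1 - (A $ i $ j)\<^sup>2\<close>.\<close>
  define x :: "real^'n" where "x = axis i 1 - (A $ i $ j) *\<^sub>R axis j 1"
  have "x $ i = 1" using assms by (simp add: x_def axis_def)
  then have "x \<noteq> 0" by auto
  then have "0 < x \<bullet> (A *v x)" by (rule posdef)
  moreover have ax: "axis k 1 \<bullet> (A *v axis l 1) = A $ k $ l" for k l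
    by (simp add: inner_axis' matrix_vector_mul_component inner_axis)
  have "A $ j $ i = A $ i $ j"
    using sym_matrix_inner[OF sym, of "axis i 1" "axis j 1"] by (simp add: ax)
  then have "x \<bullet> (A *v x) = 1 - (A $ i $ j)\<^sup>2"
    by (simp add: x_def matrix_vector_mult_diff_distrib matrix_vector_mult_scaleR
        inner_diff_left inner_diff_right ax diag power2_eq_square)
  ultimately show ?thesis by simp
qed

text \<open>Each row has squared length strictly below n, since for \<open>n \<ge> 2\<close> it
  contains an off-diagonal entry of modulus below 1. Cauchy-Schwarz row by row then bounds the
  eigenvalue. Strictness is what makes \<open>q\<close> positive.\<close>

lemma lambda_max_less_card: "lambda_max A < real CARD('n)"
proof -
  have "lambda_max A \<in> eigenvalues A"
    unfolding lambda_max_def by (intro Max_in finite_eigenvalues_sym sym eigenvalues_nonempty)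
  then obtain v where v: "v \<noteq> 0" "A *v v = lambda_max A *\<^sub>R v"
    unfolding eigenvalues_def by auto
  have row: "A $ i \<bullet> A $ i < real CARD('n)" for i
  proof -
    have "UNIV \<noteq> {i}"
      using n2 by (auto dest: arg_cong[of _ _ card])
    then obtain j where "j \<noteq> i" by auto
    then have "(\<Sum>r\<in>UNIV. (A $ i $ r)\<^sup>2) < (\<Sum>r\<in>(UNIV::'n set). 1)"
    proof (intro sum_strict_mono_ex1 ballI)
      show "(A $ i $ r)\<^sup>2 \<le> 1" for r
        using entry_sq_less_1[of i r] diag by (cases "i = r") auto
      show "\<exists>r\<in>UNIV. (A $ i $ r)\<^sup>2 < 1"
        using \<open>j \<noteq> i\<close> entry_sq_less_1[of i j] by auto
    qed simp
    then show ?thesis by (simp add: inner_vec_def power2_eq_square)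
  qed
  have "(lambda_max A)\<^sup>2 * (v \<bullet> v) = (A *v v) \<bullet> (A *v v)"
    by (simp add: v power2_eq_square)
  also have "\<dots> = (\<Sum>i\<in>UNIV. (A $ i \<bullet> v)\<^sup>2)"
    by (simp add: inner_vec_def[of "A *v v"] matrix_vector_mul_component power2_eq_square)
  also have "\<dots> \<le> (\<Sum>i\<in>UNIV. (A $ i \<bullet> A $ i) * (v \<bullet> v))"
    by (intro sum_mono Cauchy_Schwarz_ineq)
  also have "\<dots> < (\<Sum>i\<in>(UNIV::'n set). real CARD('n) * (v \<bullet> v))"
    using row v by (intro sum_strict_mono) auto
  also have "\<dots> = (real CARD('n))\<^sup>2 * (v \<bullet> v)"
    by (simp add: power2_eq_square)
  finally have "(lambda_max A)\<^sup>2 < (real CARD('n))\<^sup>2"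
    using v by simp
  then show ?thesis by (rule power2_less_imp_less) simp
qed

end

section \<open>Averages over uniform index sequences\<close>

definition avg :: "nat \<Rightarrow> ((nat \<Rightarrow> 'n::finite) \<Rightarrow> real) \<Rightarrow> real" where
  "avg N f = measure_pmf.expectation (pmf_of_set (PiE {..<N} (\<lambda>_. UNIV))) f"

text \<open>Plays the part of measurability with respect to the first \<open>k\<close>
  draws.\<close>

definition depends_upto :: "nat \<Rightarrow> ((nat \<Rightarrow> 'n) \<Rightarrow> 'a) \<Rightarrow> bool" where
  "depends_upto k f \<longleftrightarrow> (\<forall>d d'. (\<forall>i<k. d i = d' i) \<longrightarrow> f d = f d')"

lemma depends_uptoI: "(\<And>d d'. (\<And>i. i < k \<Longrightarrow> d i = d' i) \<Longrightarrow> f d = f d') \<Longrightarrow> depends_upto k f"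
  unfolding depends_upto_def by blast

lemma depends_uptoD: "depends_upto k f \<Longrightarrow> (\<And>i. i < k \<Longrightarrow> d i = d' i) \<Longrightarrow> f d = f d'"
  unfolding depends_upto_def by blast

lemma depends_upto_mono: "depends_upto k f \<Longrightarrow> k \<le> l \<Longrightarrow> depends_upto l f"
  unfolding depends_upto_def by (meson less_le_trans)

lemma avg_eq_sum:
  fixes f :: "(nat \<Rightarrow> 'n::finite) \<Rightarrow> real"
  shows "avg N f = (\<Sum>d\<in>PiE {..<N} (\<lambda>_. UNIV). f d) / real CARD('n) ^ N"
proof -
  have "PiE {..<N} (\<lambda>_. UNIV :: 'n set) \<noteq> {}" by (simp add: PiE_eq_empty_iff)
  then show ?thesis
    by (simp add: avg_def integral_pmf_of_set finite_PiE card_PiE)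
qed

lemma avg_mono: "(\<And>d. f d \<le> g d) \<Longrightarrow> avg N f \<le> avg N g"
  by (simp add: avg_eq_sum divide_right_mono sum_mono)

lemma avg_nonneg: "(\<And>d. 0 \<le> f d) \<Longrightarrow> 0 \<le> avg N f"
  by (simp add: avg_eq_sum sum_nonneg)

lemma avg_add: "avg N (\<lambda>d. f d + g d) = avg N f + avg N g"
  by (simp add: avg_eq_sum sum.distrib add_divide_distrib)

lemma avg_diff: "avg N (\<lambda>d. f d - g d) = avg N f - avg N g"
  by (simp add: avg_eq_sum sum_subtractf diff_divide_distrib)

lemma avg_cmult: "avg N (\<lambda>d. c * f d) = c * avg N f"
  unfolding avg_eq_sum sum_distrib_left[symmetric] by simp

lemma avg_sum: "avg N (\<lambda>d. \<Sum>i\<in>I. f i d) = (\<Sum>i\<in>I. avg N (f i))"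
  unfolding avg_eq_sum sum_divide_distrib[symmetric] by (subst sum.swap) (rule refl)

lemma avg_Suc:
  fixes f :: "(nat \<Rightarrow> 'n::finite) \<Rightarrow> real"
  shows "avg (Suc N) f = avg N (\<lambda>d. (\<Sum>c\<in>UNIV. f (d(N := c))) / real CARD('n))"
proof -
  have inj: "inj_on (\<lambda>(c, d). d(N := c)) (UNIV \<times> PiE {..<N} (\<lambda>_. UNIV :: 'n set))"
    by (rule inj_combinator) simp
  have "(\<Sum>d\<in>PiE {..<Suc N} (\<lambda>_. UNIV). f d)
      = (\<Sum>(c, d)\<in>UNIV \<times> PiE {..<N} (\<lambda>_. UNIV). f (d(N := c)))"
    unfolding lessThan_Suc PiE_insert_eq sum.reindex[OF inj]
    by (rule sum.cong) auto
  also have "\<dots> = (\<Sum>d\<in>PiE {..<N} (\<lambda>_. UNIV). \<Sum>c\<in>UNIV. f (d(N := c)))"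
    unfolding sum.cartesian_product[symmetric] by (rule sum.swap)
  finally show ?thesis
    unfolding avg_eq_sum sum_divide_distrib[symmetric] by simp
qed

text \<open>Draws that a function ignores average out, so quantities attached to different times can
  share one horizon \<open>N\<close>.\<close>

lemma avg_depends_upto:
  fixes f :: "(nat \<Rightarrow> 'n::finite) \<Rightarrow> real"
  assumes "depends_upto k f" "k \<le> N"
  shows "avg N f = avg k f"
  using assms(2)
proof (induction N rule: dec_induct)
  case (step N)
  have "f (d(N := c)) = f d" for d c
    by (rule depends_uptoD[OF assms(1)]) (use step in auto)
  then have "avg (Suc N) f = avg N f"
    unfolding avg_Suc by simp
  with step show ?case by simp
qed simp

text \<open>Conditioning on the first \<open>l\<close> draws: \<open>d l\<close> is independent of
  them and uniform, so it may be replaced by the mean over all its values.\<close>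

lemma avg_coordinate:
  fixes h :: "(nat \<Rightarrow> 'n::finite) \<Rightarrow> 'n \<Rightarrow> real"
  assumes dep: "\<And>c. depends_upto l (\<lambda>d. h d c)" and "l < N"
  shows "avg N (\<lambda>d. h d (d l)) = avg N (\<lambda>d. (\<Sum>c\<in>UNIV. h d c) / real CARD('n))"
proof -
  have upd: "h (d(l := c)) c' = h d c'" for d c c'
    by (rule depends_uptoD[OF dep]) auto
  have eq: "h d c = h d' c" if "\<And>i. i < l \<Longrightarrow> d i = d' i" for d d' c
    using depends_uptoD[OF dep] that by blast
  have "avg N (\<lambda>d. h d (d l)) = avg (Suc l) (\<lambda>d. h d (d l))"
    by (rule avg_depends_upto[OF depends_uptoI]) (use \<open>l < N\<close> in \<open>auto intro: eq\<close>)
  also have "\<dots> = avg l (\<lambda>d. (\<Sum>c\<in>UNIV. h d c) / real CARD('n))"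
    by (simp add: avg_Suc upd)
  also have "\<dots> = avg N (\<lambda>d. (\<Sum>c\<in>UNIV. h d c) / real CARD('n))"
  proof (rule avg_depends_upto[symmetric, OF depends_uptoI])
    fix d d' :: "nat \<Rightarrow> 'n"
    assume "\<And>i. i < l \<Longrightarrow> d i = d' i"
    then have "h d = h d'" using eq by blast
    then show "(\<Sum>c\<in>UNIV. h d c) / real CARD('n) = (\<Sum>c\<in>UNIV. h d' c) / real CARD('n)"
      by simp
  qed (use \<open>l < N\<close> in simp)
  finally show ?thesis .
qed

section \<open>Algebra of the A-inner product and of the coefficient list\<close>

lemma A_inner_commute:
  assumes "transpose A = A"
  shows "A_inner A x y = A_inner A y x"
  unfolding A_inner_def by (rule sym_matrix_inner[OF assms])

lemma A_inner_add_left: "A_inner A (x + y) z = A_inner A x z + A_inner A y z"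
  by (simp add: A_inner_def matrix_vector_right_distrib inner_add_right)

lemma A_inner_scale_left: "A_inner A (c *\<^sub>R x) z = c * A_inner A x z"
  by (simp add: A_inner_def matrix_vector_mult_scaleR)

lemma A_inner_add_right: "A_inner A x (y + z) = A_inner A x y + A_inner A x z"
  by (simp add: A_inner_def inner_add_left)

lemma A_inner_scale_right: "A_inner A x (c *\<^sub>R z) = c * A_inner A x z"
  by (simp add: A_inner_def)

lemma A_inner_minus_left: "A_inner A (- x) z = - A_inner A x z"
  using A_inner_scale_left[of A "-1" x z] by simp

lemma A_inner_sum_left: "A_inner A (\<Sum>i\<in>I. f i) z = (\<Sum>i\<in>I. A_inner A (f i) z)"
proof -
  have "A_inner A 0 z = 0" by (simp add: A_inner_def)
  then show ?thesis
    by (induction I rule: infinite_finite_induct) (auto simp: A_inner_add_left)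
qed

lemma A_inner_ebasis: "A_inner A x (ebasis c) = (A *v x) $ c"
  by (simp add: A_inner_def ebasis_def inner_axis')

lemma A_inner_ebasis_ebasis: "A_inner A (ebasis k) (ebasis c) = A $ c $ k"
  unfolding A_inner_ebasis by (simp add: ebasis_def matrix_vector_mul_component inner_axis)

lemma sum_A_inner_ebasis_sq: "(\<Sum>c\<in>UNIV. (A_inner A x (ebasis c))\<^sup>2) = (A *v x) \<bullet> (A *v x)"
  by (simp add: A_inner_ebasis inner_vec_def power2_eq_square)

lemma length_gammas [simp]: "length (gammas A b x0 \<beta> K d m) = m"
  by (induction m) (auto simp: Let_def)

lemma gammas_nth: "i < m \<Longrightarrow> gammas A b x0 \<beta> K d m ! i = gammas A b x0 \<beta> K d (Suc i) ! i"
proof (induction m)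
  case (Suc m)
  show ?case
  proof (cases "i = m")
    case False
    then have "i < m" using Suc.prems by simp
    then have "gammas A b x0 \<beta> K d (Suc m) ! i = gammas A b x0 \<beta> K d m ! i"
      by (simp add: Let_def nth_append)
    with Suc.IH[OF \<open>i < m\<close>] show ?thesis by simp
  qed simp
qed simp

section \<open>The iteration as random error vectors indexed by sets of applied updates\<close>

locale async_iteration = unit_spd_matrix A for A :: "real^'n^'n" +
  fixes b x0 :: "real^'n" and \<beta> :: real and \<tau> :: nat and K :: "nat \<Rightarrow> nat set" and N :: nat
  assumes beta: "0 \<le> \<beta>" "\<beta> < 1"
    and K_lower: "\<And>j. {i. i + \<tau> + 1 \<le> j} \<subseteq> K j"
    and K_upper: "\<And>j. K j \<subseteq> {..<j}"
begin

definition \<gamma> :: "nat \<Rightarrow> (nat \<Rightarrow> 'n) \<Rightarrow> real" where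
  "\<gamma> j d = gammas A b x0 \<beta> K d (Suc j) ! j"

definition errvec :: "nat set \<Rightarrow> (nat \<Rightarrow> 'n) \<Rightarrow> real^'n" where
  "errvec S d = x0 - xstar A b + (\<Sum>i\<in>S. (\<beta> * \<gamma> i d) *\<^sub>R ebasis (d i))"

definition sqerr :: "nat set \<Rightarrow> (nat \<Rightarrow> 'n) \<Rightarrow> real" where
  "sqerr S d = A_inner A (errvec S d) (errvec S d)"

text \<open>All expectations are over the same \<open>N\<close> draws, which makes them comparable;
  \<open>N\<close> only has to exceed every step index in use.\<close>

definition V :: "nat set \<Rightarrow> real" where
  "V S = avg N (sqerr S)"

definition G :: "nat \<Rightarrow> real" where
  "G j = avg N (\<lambda>d. (\<gamma> j d)\<^sup>2)"

definition q :: real where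
  "q = 1 - lambda_max A / real CARD('n)"

definition c :: real where
  "c = \<beta>\<^sup>2 * real \<tau> * rho2 A"

definition \<omega> :: real where
  "\<omega> = 2 * \<beta> * (1 - \<beta> - rho2 A * real \<tau>^2 * \<beta> / 2)"

lemma gamma_eq: "\<gamma> j d = - A_inner A (errvec (K j) d) (ebasis (d j))"
proof -
  have "(\<Sum>i\<in>K j. (\<beta> * gammas A b x0 \<beta> K d j ! i) *\<^sub>R ebasis (d i))
      = (\<Sum>i\<in>K j. (\<beta> * \<gamma> i d) *\<^sub>R ebasis (d i))"
  proof (rule sum.cong)
    fix i assume "i \<in> K j"
    then have "i < j" using K_upper by auto
    then show "(\<beta> * gammas A b x0 \<beta> K d j ! i) *\<^sub>R ebasis (d i) = (\<beta> * \<gamma> i d) *\<^sub>R ebasis (d i)"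
      unfolding \<gamma>_def by (subst gammas_nth) auto
  qed simp
  then have "\<gamma> j d = A_inner A (- errvec (K j) d) (ebasis (d j))"
    by (simp add: \<gamma>_def Let_def nth_append errvec_def algebra_simps)
  then show ?thesis by (simp add: A_inner_minus_left)
qed

lemma iterate_eq: "iterate A b x0 \<beta> K d m - xstar A b = errvec {..<m} d"
proof -
  have "(\<Sum>i<m. (\<beta> * gammas A b x0 \<beta> K d m ! i) *\<^sub>R ebasis (d i))
      = (\<Sum>i<m. (\<beta> * \<gamma> i d) *\<^sub>R ebasis (d i))"
    unfolding \<gamma>_def by (rule sum.cong[OF refl]) (subst gammas_nth, auto)
  then show ?thesis by (simp add: iterate_def errvec_def)
qed

text \<open>The coefficients and the error vectors are mutually recursive, so the dependence of the
  coefficients is a hypothesis here, supplied by the induction in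
  \<open>depends_gamma\<close>.\<close>

lemma depends_errvec_aux:
  assumes "\<And>i. i \<in> S \<Longrightarrow> depends_upto l (\<gamma> i)" "S \<subseteq> {..<l}"
  shows "depends_upto l (errvec S)"
proof (rule depends_uptoI)
  fix d d' :: "nat \<Rightarrow> 'n"
  assume eq: "\<And>i. i < l \<Longrightarrow> d i = d' i"
  have "(\<beta> * \<gamma> i d) *\<^sub>R ebasis (d i) = (\<beta> * \<gamma> i d') *\<^sub>R ebasis (d' i)" if "i \<in> S" for i
    using depends_uptoD[OF assms(1)[OF that] eq] eq[of i] that assms(2) by auto
  then show "errvec S d = errvec S d'"
    unfolding errvec_def by simp
qed

lemma depends_gamma: "depends_upto (Suc j) (\<gamma> j)"
proof (induction j rule: less_induct)
  case (less j)
  have "depends_upto j (errvec (K j))"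
  proof (rule depends_errvec_aux)
    fix i assume "i \<in> K j"
    then have "i < j" using K_upper by auto
    then show "depends_upto j (\<gamma> i)" using less depends_upto_mono Suc_leI by blast
  qed (rule K_upper)
  then have "errvec (K j) d = errvec (K j) d'" if "\<And>i. i < Suc j \<Longrightarrow> d i = d' i" for d d'
    by (rule depends_uptoD) (use that in auto)
  then show ?case
    unfolding gamma_eq[abs_def] by (intro depends_uptoI) (metis lessI)
qed

lemma depends_errvec: "S \<subseteq> {..<l} \<Longrightarrow> depends_upto l (errvec S)"
  by (rule depends_errvec_aux) (use depends_gamma depends_upto_mono Suc_leI in blast)+

lemma depends_sqerr: "S \<subseteq> {..<l} \<Longrightarrow> depends_upto l (sqerr S)"
  using depends_uptoD[OF depends_errvec] unfolding sqerr_def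
  by (intro depends_uptoI) metis

lemma err_exp_eq: "m \<le> N \<Longrightarrow> err_exp A b x0 \<beta> K m = V {..<m}"
  using avg_depends_upto[OF depends_sqerr[of "{..<m}" m], of N]
  by (simp add: V_def err_exp_def avg_def A_norm_def iterate_eq sqerr_def[abs_def] A_inner_def psd)

section \<open>One-step estimates in expectation\<close>

lemma sqerr_nonneg: "0 \<le> sqerr S d"
  by (simp add: sqerr_def A_inner_def psd)

lemma V_nonneg: "0 \<le> V S"
  unfolding V_def by (intro avg_nonneg sqerr_nonneg)

lemma G_nonneg: "0 \<le> G j"
  unfolding G_def by (intro avg_nonneg) simp

lemma lambda_max_pos: "0 < lambda_max A"
  using lambda_min_pos lambda_min_le_max by linarith

lemma q_bounds: "0 < q" "q < 1"
  using lambda_max_pos lambda_max_less_card by (auto simp: q_def)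

lemma rho2_row: "(\<Sum>r\<in>UNIV. (A $ l $ r)\<^sup>2) / real CARD('n) \<le> rho2 A"
  unfolding rho2_def by (rule Max_ge) (auto intro!: image_eqI)

lemma rho2_nonneg: "0 \<le> rho2 A"
  by (rule order_trans[OF _ rho2_row]) (simp add: sum_nonneg)

lemma c_nonneg: "0 \<le> c"
  by (simp add: c_def rho2_nonneg)

text \<open>Direction \<open>d l\<close> is independent of \<open>errvec S\<close>, and the squared
  coordinates of \<open>A *v errvec S d\<close> add up to its squared length.\<close>

lemma avg_inner_ebasis_sq:
  assumes "S \<subseteq> {..<l}" "l < N"
  shows "avg N (\<lambda>d. (A_inner A (errvec S d) (ebasis (d l)))\<^sup>2)
    = avg N (\<lambda>d. ((A *v errvec S d) \<bullet> (A *v errvec S d)) / real CARD('n))"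
proof -
  have "depends_upto l (\<lambda>d. (A_inner A (errvec S d) (ebasis k))\<^sup>2)" for k
    using depends_uptoD[OF depends_errvec[OF assms(1)]] by (intro depends_uptoI) metis
  from avg_coordinate[where h = "\<lambda>d k. (A_inner A (errvec S d) (ebasis k))\<^sup>2", OF this \<open>l < N\<close>]
  show ?thesis
    by (simp add: sum_A_inner_ebasis_sq)
qed

lemma avg_inner_ebasis_sq_le:
  assumes "S \<subseteq> {..<l}" "l < N"
  shows "avg N (\<lambda>d. (A_inner A (errvec S d) (ebasis (d l)))\<^sup>2) \<le> lambda_max A / real CARD('n) * V S"
  unfolding avg_inner_ebasis_sq[OF assms] V_def avg_cmult[symmetric]
proof (rule avg_mono)
  fix d
  have "(A *v errvec S d) \<bullet> (A *v errvec S d) / real CARD('n)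
      \<le> lambda_max A * sqerr S d / real CARD('n)"
    unfolding sqerr_def A_inner_def by (intro divide_right_mono norm_image_le) simp
  then show "(A *v errvec S d) \<bullet> (A *v errvec S d) / real CARD('n)
      \<le> lambda_max A / real CARD('n) * sqerr S d"
    by simp
qed

lemma avg_inner_ebasis_sq_ge:
  assumes "S \<subseteq> {..<l}" "l < N"
  shows "lambda_min A / real CARD('n) * V S \<le> avg N (\<lambda>d. (A_inner A (errvec S d) (ebasis (d l)))\<^sup>2)"
  unfolding avg_inner_ebasis_sq[OF assms] V_def avg_cmult[symmetric]
proof (rule avg_mono)
  fix d
  have "lambda_min A * sqerr S d / real CARD('n)
      \<le> (A *v errvec S d) \<bullet> (A *v errvec S d) / real CARD('n)"
    unfolding sqerr_def A_inner_def by (intro divide_right_mono norm_image_ge) simp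
  then show "lambda_min A / real CARD('n) * sqerr S d
      \<le> (A *v errvec S d) \<bullet> (A *v errvec S d) / real CARD('n)"
    by simp
qed

lemma G_le: "j < N \<Longrightarrow> G j \<le> lambda_max A / real CARD('n) * V (K j)"
  using avg_inner_ebasis_sq_le[OF K_upper] by (simp add: G_def gamma_eq)

lemma G_ge: "j < N \<Longrightarrow> lambda_min A / real CARD('n) * V (K j) \<le> G j"
  using avg_inner_ebasis_sq_ge[OF K_upper] by (simp add: G_def gamma_eq)

lemma sqerr_insert:
  assumes "finite S" "l \<notin> S"
  shows "sqerr (insert l S) d
    = sqerr S d + 2 * (\<beta> * \<gamma> l d) * A_inner A (errvec S d) (ebasis (d l)) + (\<beta> * \<gamma> l d)\<^sup>2"
proof -
  have "errvec (insert l S) d = errvec S d + (\<beta> * \<gamma> l d) *\<^sub>R ebasis (d l)"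
    using assms by (simp add: errvec_def)
  moreover have "A_inner A (ebasis (d l)) (ebasis (d l)) = 1"
    by (simp add: A_inner_ebasis_ebasis diag)
  ultimately show ?thesis
    using A_inner_commute[OF sym, of "ebasis (d l)" "errvec S d"]
    by (simp add: sqerr_def A_inner_add_left A_inner_scale_left A_inner_add_right
        A_inner_scale_right power2_eq_square algebra_simps)
qed

text \<open>No step along a fresh direction, whatever its length, can reduce the expected error by
  more than the exact line search does.\<close>

lemma V_insert_ge:
  assumes "S \<subseteq> {..<l}" "l < N"
  shows "q * V S \<le> V (insert l S)"
proof -
  have "finite S" "l \<notin> S" using assms finite_subset by auto
  \<comment> \<open>Completing the square in the step length; the square vanishes for exact line
    search.\<close>
  then have "sqerr S d - (A_inner A (errvec S d) (ebasis (d l)))\<^sup>2 \<le> sqerr (insert l S) d" for d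
    using zero_le_power2[of "\<beta> * \<gamma> l d + A_inner A (errvec S d) (ebasis (d l))"]
    by (simp add: sqerr_insert power2_eq_square algebra_simps)
  then have "V S - avg N (\<lambda>d. (A_inner A (errvec S d) (ebasis (d l)))\<^sup>2) \<le> V (insert l S)"
    unfolding V_def avg_diff[symmetric] by (rule avg_mono)
  then show ?thesis
    using avg_inner_ebasis_sq_le[OF assms] by (simp add: q_def algebra_simps)
qed

text \<open>Indices between \<open>a\<close> and \<open>m\<close> that are absent from
  \<open>S\<close> cost nothing because \<open>q < 1\<close>, so \<open>S\<close> need not be a
  prefix.\<close>

lemma V_ge_power:
  assumes "a \<le> m" "{..<a} \<subseteq> S" "S \<subseteq> {..<m}" "m \<le> N"
  shows "q ^ (m - a) * V {..<a} \<le> V S"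
  using assms
proof (induction m arbitrary: S rule: dec_induct)
  case base
  then have "S = {..<a}" by auto
  then show ?case by simp
next
  case (step m)
  define S' where "S' = S \<inter> {..<m}"
  have IH: "q ^ (m - a) * V {..<a} \<le> V S'"
    using step by (intro step.IH) (auto simp: S'_def)
  have "q ^ (Suc m - a) * V {..<a} = q * (q ^ (m - a) * V {..<a})"
    using step by (simp add: Suc_diff_le)
  also have "\<dots> \<le> q * V S'"
    using IH q_bounds by simp
  also have "\<dots> \<le> V S"
  proof (cases "m \<in> S")
    case True
    then have "S = insert m S'" using step.prems by (auto simp: S'_def less_Suc_eq)
    then show ?thesis using V_insert_ge[of S' m] step.prems by (auto simp: S'_def)
  next
    case False
    then have "S = S'" using step.prems by (auto simp: S'_def less_Suc_eq)
    then show ?thesis using q_bounds mult_right_mono[of q 1 "V S'"] V_nonneg[of S'] by simp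
  qed
  finally show ?case .
qed

text \<open>Both \<open>S\<close> and \<open>K l\<close> contain every index older than the delay
  window, so they differ only inside it, with coefficients -1, 0 or 1.\<close>

lemma errvec_diff:
  assumes "{i. i + \<tau> + 1 \<le> l} \<subseteq> S" "S \<subseteq> {..<l}"
  shows "errvec S d = errvec (K l) d
    + (\<Sum>i\<in>{l - \<tau>..<l}. ((of_bool (i \<in> S) - of_bool (i \<in> K l)) * (\<beta> * \<gamma> i d)) *\<^sub>R ebasis (d i))"
proof -
  define f where "f i = (\<beta> * \<gamma> i d) *\<^sub>R ebasis (d i)" for i
  have ext: "sum f T = (\<Sum>i<l. of_bool (i \<in> T) *\<^sub>R f i)" if "T \<subseteq> {..<l}" for T
    using that by (intro sum.mono_neutral_cong_left) auto
  have "sum f S - sum f (K l) = (\<Sum>i<l. (of_bool (i \<in> S) - of_bool (i \<in> K l)) *\<^sub>R f i)"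
    unfolding ext[OF assms(2)] ext[OF K_upper] by (simp only: sum_subtractf[symmetric] scaleR_diff_left)
  also have "\<dots> = (\<Sum>i\<in>{l - \<tau>..<l}. (of_bool (i \<in> S) - of_bool (i \<in> K l)) *\<^sub>R f i)"
  proof (rule sum.mono_neutral_right)
    show "\<forall>i\<in>{..<l} - {l - \<tau>..<l}. (of_bool (i \<in> S) - of_bool (i \<in> K l)) *\<^sub>R f i = 0"
    proof
      fix i assume "i \<in> {..<l} - {l - \<tau>..<l}"
      then have "i + \<tau> + 1 \<le> l" by auto
      then have "i \<in> S" "i \<in> K l" using assms(1) K_lower by auto
      then show "(of_bool (i \<in> S) - of_bool (i \<in> K l)) *\<^sub>R f i = 0" by simp
    qed
  qed auto
  finally show ?thesis
    by (simp add: errvec_def f_def algebra_simps)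
qed

text \<open>The inner product of the error with the new direction is
  \<open>- \<gamma> l d + \<beta> * D\<close>, where \<open>D\<close> collects the mismatched
  updates. The cross term is split by
  \<open>2 * \<gamma> * D \<le> \<gamma>\<^sup>2 + D\<^sup>2\<close>, and Cauchy-Schwarz over at
  most \<open>\<tau>\<close> summands bounds \<open>D\<^sup>2\<close>.\<close>

lemma sqerr_insert_le:
  assumes "{i. i + \<tau> + 1 \<le> l} \<subseteq> S" "S \<subseteq> {..<l}"
  shows "sqerr (insert l S) d \<le> sqerr S d - 2 * \<beta> * (1 - \<beta>) * (\<gamma> l d)\<^sup>2
    + \<beta>\<^sup>2 * real \<tau> * (\<Sum>i\<in>{l - \<tau>..<l}. (\<gamma> i d)\<^sup>2 * (A $ d l $ d i)\<^sup>2)"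
proof -
  define \<sigma> :: "nat \<Rightarrow> real" where "\<sigma> i = of_bool (i \<in> S) - of_bool (i \<in> K l)" for i
  define W where "W = {l - \<tau>..<l}"
  define D where "D = (\<Sum>i\<in>W. \<sigma> i * \<gamma> i d * A $ d l $ d i)"
  have fin: "finite S" "l \<notin> S" using assms finite_subset by auto
  have inner: "A_inner A (errvec S d) (ebasis (d l)) = - \<gamma> l d + \<beta> * D"
    unfolding errvec_diff[OF assms] gamma_eq[of l] D_def W_def \<sigma>_def
    by (simp add: A_inner_add_left A_inner_sum_left A_inner_scale_left A_inner_ebasis_ebasis
        sum_distrib_left mult_ac)
  have "D\<^sup>2 \<le> (\<Sum>i\<in>W. (\<sigma> i * \<gamma> i d * A $ d l $ d i)\<^sup>2) * (\<Sum>i\<in>W. 1\<^sup>2)"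
    using Cauchy_Schwarz_ineq_sum[of "\<lambda>i. \<sigma> i * \<gamma> i d * A $ d l $ d i" "\<lambda>i. 1" W]
    by (simp add: D_def)
  also have "\<dots> \<le> (\<Sum>i\<in>W. (\<gamma> i d)\<^sup>2 * (A $ d l $ d i)\<^sup>2) * real \<tau>"
  proof (rule mult_mono)
    have "(\<sigma> i)\<^sup>2 \<le> 1" for i by (simp add: \<sigma>_def)
    then show "(\<Sum>i\<in>W. (\<sigma> i * \<gamma> i d * A $ d l $ d i)\<^sup>2) \<le> (\<Sum>i\<in>W. (\<gamma> i d)\<^sup>2 * (A $ d l $ d i)\<^sup>2)"
      by (intro sum_mono) (simp add: power_mult_distrib mult_left_le_one_le mult.assoc)
  qed (auto simp: W_def sum_nonneg)
  finally have D: "D\<^sup>2 \<le> real \<tau> * (\<Sum>i\<in>W. (\<gamma> i d)\<^sup>2 * (A $ d l $ d i)\<^sup>2)"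
    by (simp add: mult.commute)
  have "sqerr (insert l S) d = sqerr S d - 2 * \<beta> * (1 - \<beta> / 2) * (\<gamma> l d)\<^sup>2 + \<beta>\<^sup>2 * (2 * \<gamma> l d * D)"
    by (simp add: sqerr_insert[OF fin] inner power2_eq_square algebra_simps)
  also have "\<dots> \<le> sqerr S d - 2 * \<beta> * (1 - \<beta> / 2) * (\<gamma> l d)\<^sup>2 + \<beta>\<^sup>2 * ((\<gamma> l d)\<^sup>2 + D\<^sup>2)"
    by (intro add_left_mono mult_left_mono sum_squares_bound) simp
  also have "\<dots> = sqerr S d - 2 * \<beta> * (1 - \<beta>) * (\<gamma> l d)\<^sup>2 + \<beta>\<^sup>2 * D\<^sup>2"
    by (simp add: power2_eq_square algebra_simps)
  also have "\<dots> \<le> sqerr S d - 2 * \<beta> * (1 - \<beta>) * (\<gamma> l d)\<^sup>2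
      + \<beta>\<^sup>2 * (real \<tau> * (\<Sum>i\<in>W. (\<gamma> i d)\<^sup>2 * (A $ d l $ d i)\<^sup>2))"
    by (intro add_left_mono mult_left_mono D) simp
  finally show ?thesis by (simp add: W_def mult.assoc)
qed

lemma avg_gamma_entry_le:
  assumes "i < l" "l < N"
  shows "avg N (\<lambda>d. (\<gamma> i d)\<^sup>2 * (A $ d l $ d i)\<^sup>2) \<le> rho2 A * G i"
proof -
  \<comment> \<open>Averaging over \<open>d l\<close> runs down column \<open>d i\<close>, whereas
    \<open>rho2\<close> bounds row means.\<close>
  have entry: "A $ k $ r = A $ r $ k" for k r
    using arg_cong[OF sym, of "\<lambda>B. B $ r $ k"] by (simp add: transpose_def)
  have "depends_upto l (\<lambda>d. (\<gamma> i d)\<^sup>2 * (A $ k $ d i)\<^sup>2)" for k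
  proof (rule depends_uptoI)
    fix d d' :: "nat \<Rightarrow> 'n"
    assume eq: "\<And>i. i < l \<Longrightarrow> d i = d' i"
    have "\<gamma> i d = \<gamma> i d'"
      by (rule depends_uptoD[OF depends_gamma]) (use eq assms in auto)
    then show "(\<gamma> i d)\<^sup>2 * (A $ k $ d i)\<^sup>2 = (\<gamma> i d')\<^sup>2 * (A $ k $ d' i)\<^sup>2"
      using eq[OF \<open>i < l\<close>] by simp
  qed
  from avg_coordinate[where h = "\<lambda>d k. (\<gamma> i d)\<^sup>2 * (A $ k $ d i)\<^sup>2", OF this \<open>l < N\<close>]
  have "avg N (\<lambda>d. (\<gamma> i d)\<^sup>2 * (A $ d l $ d i)\<^sup>2)
      = avg N (\<lambda>d. (\<gamma> i d)\<^sup>2 * ((\<Sum>k\<in>UNIV. (A $ d i $ k)\<^sup>2) / real CARD('n)))"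
    by (subst (asm) entry) (simp add: sum_distrib_left)
  also have "\<dots> \<le> avg N (\<lambda>d. rho2 A * (\<gamma> i d)\<^sup>2)"
    by (subst mult.commute) (intro avg_mono mult_right_mono rho2_row zero_le_power2)
  also have "\<dots> = rho2 A * G i"
    by (simp add: avg_cmult G_def)
  finally show ?thesis .
qed

lemma V_insert_le:
  assumes "{i. i + \<tau> + 1 \<le> l} \<subseteq> S" "S \<subseteq> {..<l}" "l < N"
  shows "V (insert l S) \<le> V S - 2 * \<beta> * (1 - \<beta>) * G l + c * (\<Sum>i\<in>{l - \<tau>..<l}. G i)"
proof -
  have "V (insert l S) \<le> avg N (\<lambda>d. sqerr S d - 2 * \<beta> * (1 - \<beta>) * (\<gamma> l d)\<^sup>2
    + \<beta>\<^sup>2 * real \<tau> * (\<Sum>i\<in>{l - \<tau>..<l}. (\<gamma> i d)\<^sup>2 * (A $ d l $ d i)\<^sup>2))"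
    unfolding V_def by (intro avg_mono sqerr_insert_le assms)
  also have "\<dots> = V S - 2 * \<beta> * (1 - \<beta>) * G l
    + \<beta>\<^sup>2 * real \<tau> * (\<Sum>i\<in>{l - \<tau>..<l}. avg N (\<lambda>d. (\<gamma> i d)\<^sup>2 * (A $ d l $ d i)\<^sup>2))"
    by (simp only: avg_add avg_diff avg_cmult avg_sum V_def G_def)
  also have "\<dots> \<le> V S - 2 * \<beta> * (1 - \<beta>) * G l
    + \<beta>\<^sup>2 * real \<tau> * (\<Sum>i\<in>{l - \<tau>..<l}. rho2 A * G i)"
    using assms(3) by (intro add_left_mono mult_left_mono sum_mono avg_gamma_entry_le) auto
  finally show ?thesis
    by (simp add: c_def sum_distrib_left mult_ac)
qed

end

section \<open>Counting in sums over sliding windows\<close>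

lemma staircase_sum_le: "2 * (\<Sum>k<M. t - k) \<le> t * (t + 1 :: nat)"
proof (induction M arbitrary: t)
  case (Suc M)
  \<comment> \<open>Peeling off \<open>k = 0\<close> leaves the same sum for \<open>t - 1\<close>.
    Truncated subtraction makes all terms beyond \<open>t\<close> vanish, so \<open>M\<close> is
    irrelevant.\<close>
  have "2 * (\<Sum>k<Suc M. t - k) = 2 * t + 2 * (\<Sum>k<M. (t - 1) - k)"
    by (simp add: sum.lessThan_Suc_shift del: sum.lessThan_Suc)
  also have "\<dots> \<le> 2 * t + (t - 1) * (t - 1 + 1)"
    using Suc.IH[of "t - 1"] by simp
  also have "\<dots> \<le> t * (t + 1)"
    by (cases t) auto
  finally show ?case .
qed simp

text \<open>An index from \<open>s\<close> on lies in at most \<open>t\<close> windows. The window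
  of \<open>j\<close> reaches below \<open>s\<close> in at most \<open>t - (j - s)\<close> places,
  each worth at most \<open>B\<close>, and these counts form a staircase.\<close>

lemma window_double_sum_le:
  fixes g :: "nat \<Rightarrow> real"
  assumes g: "\<And>i. 0 \<le> g i" and "0 \<le> B"
    and B: "\<And>i. i < s \<Longrightarrow> s \<le> i + t \<Longrightarrow> g i \<le> B"
  shows "(\<Sum>j\<in>{s..<m}. \<Sum>i\<in>{j - t..<j}. g i)
    \<le> real t * (\<Sum>i\<in>{s..<m}. g i) + real t * (real t + 1) / 2 * B"
proof -
  have split: "(\<Sum>i\<in>{j - t..<j}. g i)
      \<le> (\<Sum>i\<in>{s..<m}. of_bool (i < j \<and> j \<le> i + t) * g i) + real (t - (j - s)) * B"
    if j: "j \<in> {s..<m}" for j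
  proof -
    have "(\<Sum>i\<in>{j - t..<j}. g i) = (\<Sum>i\<in>{j - t..<j} \<inter> {s..}. g i) + (\<Sum>i\<in>{j - t..<j} - {s..}. g i)"
      by (rule sum.Int_Diff) simp
    also have "(\<Sum>i\<in>{j - t..<j} \<inter> {s..}. g i) = (\<Sum>i\<in>{s..<m}. of_bool (i < j \<and> j \<le> i + t) * g i)"
      using j by (intro sum.mono_neutral_cong_left) auto
    also have "(\<Sum>i\<in>{j - t..<j} - {s..}. g i) \<le> (\<Sum>i\<in>{j - t..<j} - {s..}. B)"
      using j by (intro sum_mono B) auto
    also have "\<dots> = real (card ({j - t..<j} - {s..})) * B"
      by simp
    also have "\<dots> \<le> real (t - (j - s)) * B"
    proof (rule mult_right_mono)
      have "card ({j - t..<j} - {s..}) \<le> card {j - t..<s}"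
        by (rule card_mono) auto
      then show "real (card ({j - t..<j} - {s..})) \<le> real (t - (j - s))"
        using j by auto
    qed fact
    finally show ?thesis by simp
  qed
  have near: "(\<Sum>j\<in>{s..<m}. of_bool (i < j \<and> j \<le> i + t) * g i) \<le> real t * g i" for i
  proof -
    have "(\<Sum>j\<in>{s..<m}. of_bool (i < j \<and> j \<le> i + t) :: real) = (\<Sum>j\<in>{s..<m} \<inter> {i<..i + t}. 1)"
      by (rule sum.mono_neutral_cong_right) auto
    also have "\<dots> \<le> (\<Sum>j\<in>{i<..i + t}. 1)"
      by (rule sum_mono2) auto
    finally have "(\<Sum>j\<in>{s..<m}. of_bool (i < j \<and> j \<le> i + t) :: real) \<le> real t"
      by simp
    then have "(\<Sum>j\<in>{s..<m}. of_bool (i < j \<and> j \<le> i + t)) * g i \<le> real t * g i"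
      using g by (intro mult_right_mono) auto
    then show ?thesis by (simp add: sum_distrib_right)
  qed
  have "(\<Sum>j\<in>{s..<m}. t - (j - s)) = (\<Sum>k<m - s. t - k)"
    by (rule sum.reindex_bij_witness[where i = "\<lambda>k. k + s" and j = "\<lambda>j. j - s"]) auto
  then have "2 * (\<Sum>j\<in>{s..<m}. t - (j - s)) \<le> t * (t + 1)"
    using staircase_sum_le by simp
  then have "real (2 * (\<Sum>j\<in>{s..<m}. t - (j - s))) \<le> real (t * (t + 1))"
    by (simp only: of_nat_le_iff)
  then have far: "(\<Sum>j\<in>{s..<m}. real (t - (j - s))) \<le> real t * (real t + 1) / 2"
    by (simp add: algebra_simps)
  have "(\<Sum>j\<in>{s..<m}. \<Sum>i\<in>{j - t..<j}. g i)
      \<le> (\<Sum>j\<in>{s..<m}. \<Sum>i\<in>{s..<m}. of_bool (i < j \<and> j \<le> i + t) * g i)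
        + (\<Sum>j\<in>{s..<m}. real (t - (j - s)) * B)"
    unfolding sum.distrib[symmetric] by (rule sum_mono) (rule split)
  also have "(\<Sum>j\<in>{s..<m}. \<Sum>i\<in>{s..<m}. of_bool (i < j \<and> j \<le> i + t) * g i)
      = (\<Sum>i\<in>{s..<m}. \<Sum>j\<in>{s..<m}. of_bool (i < j \<and> j \<le> i + t) * g i)"
    by (rule sum.swap)
  also have "\<dots> \<le> (\<Sum>i\<in>{s..<m}. real t * g i)"
    by (intro sum_mono near)
  also have "(\<Sum>j\<in>{s..<m}. real (t - (j - s)) * B) \<le> real t * (real t + 1) / 2 * B"
    unfolding sum_distrib_right[symmetric] by (rule mult_right_mono[OF far]) fact
  finally show ?thesis by (simp add: sum_distrib_left)
qed

section \<open>Descent over many steps and control of stale reads\<close>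

context async_iteration
begin

definition \<psi> :: real where
  "\<psi> = rho2 A * real \<tau>^3 * \<beta>^2 * lambda_max A * (1 / q^(2*\<tau>)) / real CARD('n)"

lemma omega_eq: "\<omega> = 2 * \<beta> * (1 - \<beta>) - c * real \<tau>"
  by (simp add: \<omega>_def c_def power2_eq_square algebra_simps)

lemma V_lessThan_le_sum:
  assumes "s \<le> m" "m \<le> N"
  shows "V {..<m} \<le> V {..<s} - 2 * \<beta> * (1 - \<beta>) * (\<Sum>j\<in>{s..<m}. G j)
    + c * (\<Sum>j\<in>{s..<m}. \<Sum>i\<in>{j - \<tau>..<j}. G i)"
  using assms
proof (induction m rule: dec_induct)
  case (step m)
  have "V {..<Suc m} \<le> V {..<m} - 2 * \<beta> * (1 - \<beta>) * G m + c * (\<Sum>i\<in>{m - \<tau>..<m}. G i)"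
    unfolding lessThan_Suc using step by (intro V_insert_le) auto
  with step show ?case by (simp add: algebra_simps)
qed simp

lemma V_lessThan_descent:
  assumes "s \<le> m" "m \<le> N" "0 \<le> B" "\<And>i. i < s \<Longrightarrow> s \<le> i + \<tau> \<Longrightarrow> G i \<le> B"
  shows "V {..<m} \<le> V {..<s} - \<omega> * (\<Sum>j\<in>{s..<m}. G j) + c * (real \<tau> * (real \<tau> + 1) / 2 * B)"
proof -
  have "c * (\<Sum>j\<in>{s..<m}. \<Sum>i\<in>{j - \<tau>..<j}. G i)
      \<le> c * (real \<tau> * (\<Sum>j\<in>{s..<m}. G j) + real \<tau> * (real \<tau> + 1) / 2 * B)"
    by (intro mult_left_mono window_double_sum_le G_nonneg c_nonneg assms)
  with V_lessThan_le_sum[OF assms(1,2)] show ?thesis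
    by (simp add: omega_eq algebra_simps)
qed

text \<open>From time \<open>a\<close> on every read contains the first \<open>s\<close> updates, so
  \<open>V (K j)\<close> is at least \<open>q ^ (j - s) * V {..<s}\<close>. The geometric sum is at
  least half its limit by the last hypothesis, and \<open>1 - q = lambda_max A / n\<close> turns
  \<open>lambda_min A / n\<close> into \<open>1 / (2 * cond_num A)\<close>.\<close>

lemma G_sum_ge:
  assumes "s \<le> a" "a \<le> m" "m \<le> N" "\<And>j. a \<le> j \<Longrightarrow> {..<s} \<subseteq> K j" "q ^ (m - a) \<le> 1 / 2"
  shows "q ^ (a - s) / (2 * cond_num A) * V {..<s} \<le> (\<Sum>j\<in>{s..<m}. G j)"
proof -
  have lmax: "1 - q = lambda_max A / real CARD('n)" by (simp add: q_def)
  have "(\<Sum>j\<in>{a..<m}. q ^ (j - s)) = (\<Sum>k<m - a. q ^ (a - s) * q ^ k)"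
    using assms(1) by (intro sum.reindex_bij_witness[where i = "\<lambda>k. k + a" and j = "\<lambda>j. j - a"])
      (auto simp flip: power_add)
  also have "\<dots> = q ^ (a - s) * ((1 - q ^ (m - a)) / (1 - q))"
    using q_bounds by (simp add: sum_gp_strict flip: sum_distrib_left)
  finally have geo: "(\<Sum>j\<in>{a..<m}. q ^ (j - s)) = q ^ (a - s) * ((1 - q ^ (m - a)) / (1 - q))" .
  have "q ^ (a - s) / (2 * cond_num A) = (lambda_min A / real CARD('n)) * (q ^ (a - s) * ((1 / 2) / (1 - q)))"
    using lambda_min_pos lambda_max_pos by (simp add: lmax cond_num_def field_simps)
  also have "\<dots> \<le> (lambda_min A / real CARD('n)) * (q ^ (a - s) * ((1 - q ^ (m - a)) / (1 - q)))"
    using assms(5) q_bounds lambda_min_pos by (intro mult_left_mono divide_right_mono) auto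
  finally have "q ^ (a - s) / (2 * cond_num A) * V {..<s}
      \<le> (lambda_min A / real CARD('n)) * (\<Sum>j\<in>{a..<m}. q ^ (j - s)) * V {..<s}"
    unfolding geo by (rule mult_right_mono) (rule V_nonneg)
  also have "\<dots> = (\<Sum>j\<in>{a..<m}. lambda_min A / real CARD('n) * (q ^ (j - s) * V {..<s}))"
    unfolding sum_distrib_left sum_distrib_right by (simp only: mult.assoc)
  also have "\<dots> \<le> (\<Sum>j\<in>{a..<m}. G j)"
  proof (rule sum_mono)
    fix j assume j: "j \<in> {a..<m}"
    have "lambda_min A / real CARD('n) * (q ^ (j - s) * V {..<s}) \<le> lambda_min A / real CARD('n) * V (K j)"
      using j assms K_upper lambda_min_pos by (intro mult_left_mono V_ge_power) auto
    also have "\<dots> \<le> G j" using j assms by (intro G_ge) auto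
    finally show "lambda_min A / real CARD('n) * (q ^ (j - s) * V {..<s}) \<le> G j" .
  qed
  also have "\<dots> \<le> (\<Sum>j\<in>{s..<m}. G j)"
    using assms(1) G_nonneg by (intro sum_mono2) auto
  finally show ?thesis .
qed

text \<open>The lower bound read backwards: errors shrink by at most \<open>q\<close> per step, so a
  later error controls an earlier one.\<close>

lemma V_lessThan_le_later:
  assumes "a \<le> m" "m \<le> a + k" "m \<le> N"
  shows "V {..<a} \<le> V {..<m} / q ^ k"
proof -
  have "q ^ k * V {..<a} \<le> q ^ (m - a) * V {..<a}"
    using assms q_bounds by (intro mult_right_mono V_nonneg power_decreasing) auto
  also have "\<dots> \<le> V {..<m}"
    using assms by (intro V_ge_power) auto
  finally show ?thesis using q_bounds by (simp add: field_simps)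
qed

text \<open>A stale set \<^term>\<open>K i\<close> need not be a prefix, so its error is not controlled by
  the lower bounds above. Adding the elements of \<^term>\<open>K i\<close> one at a time to the prefix it contains, the descent
  inequality applies at each step, and the accumulated growth is at most the fraction
  \<^term>\<open>\<psi>\<close> of earlier errors of the same kind.\<close>

lemma V_K_le:
  assumes "\<psi> \<le> 1 / 4" "i < N"
  shows "V (K i) \<le> 4 / 3 * V {..<i - \<tau>}"
  using assms(2)
proof (induction i rule: less_induct)
  case (less i)
  define p where "p = i - \<tau>"
  \<comment> \<open>One bound for all windows met below: they start at most
    \<open>2 * \<tau>\<close> before \<open>i\<close>, and then \<open>k - \<tau>\<close> lies at
    most \<open>2 * \<tau>\<close> before \<open>p\<close>.\<close>
  define B where "B = lambda_max A / real CARD('n) * (4 / 3 * (V {..<p} / q ^ (2 * \<tau>)))"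
  have B: "G k \<le> B" if "k < i" "i \<le> k + 2 * \<tau>" for k
  proof -
    have "G k \<le> lambda_max A / real CARD('n) * V (K k)"
      using that less.prems by (intro G_le) simp
    also have "\<dots> \<le> lambda_max A / real CARD('n) * (4 / 3 * V {..<k - \<tau>})"
      using that less lambda_max_pos by (intro mult_left_mono less.IH) auto
    also have "\<dots> \<le> B"
      unfolding B_def p_def using that less.prems lambda_max_pos
      by (intro mult_left_mono V_lessThan_le_later) auto
    finally show ?thesis .
  qed
  have B0: "0 \<le> B"
    unfolding B_def using lambda_max_pos q_bounds V_nonneg by simp
  \<comment> \<open>As \<open>m \<le> i\<close>, the prefix below \<open>p\<close> already holds
    every old index that \<open>V_insert_le\<close> demands.\<close>
  have step: "V ({..<p} \<union> (K i \<inter> {..<m})) \<le> V {..<p} + c * (real (m - p) * (real \<tau> * B))"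
    if "p \<le> m" "m \<le> i" for m
    using that
  proof (induction m rule: dec_induct)
    case base
    have "{..<p} \<union> (K i \<inter> {..<p}) = {..<p}" by auto
    then show ?case by simp
  next
    case (step m)
    define S where "S = {..<p} \<union> (K i \<inter> {..<m})"
    have IH: "V S \<le> V {..<p} + c * (real (m - p) * (real \<tau> * B))"
      using step by (simp add: S_def)
    have "V ({..<p} \<union> (K i \<inter> {..<Suc m})) \<le> V S + c * (real \<tau> * B)"
    proof (cases "m \<in> K i")
      case True
      have "(\<Sum>k\<in>{m - \<tau>..<m}. G k) \<le> (\<Sum>k\<in>{m - \<tau>..<m}. B)"
        using step.prems step.hyps by (intro sum_mono B) (auto simp: p_def)
      also have "\<dots> \<le> real \<tau> * B"
        using B0 by (auto intro: mult_right_mono)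
      finally have W: "c * (\<Sum>k\<in>{m - \<tau>..<m}. G k) \<le> c * (real \<tau> * B)"
        by (rule mult_left_mono) (rule c_nonneg)
      have "{..<p} \<union> (K i \<inter> {..<Suc m}) = insert m S"
        using True by (auto simp: S_def less_Suc_eq)
      moreover have "V (insert m S) \<le> V S - 2 * \<beta> * (1 - \<beta>) * G m + c * (\<Sum>k\<in>{m - \<tau>..<m}. G k)"
        using step less.prems by (intro V_insert_le) (auto simp: S_def p_def)
      moreover have "0 \<le> 2 * \<beta> * (1 - \<beta>) * G m"
        using beta G_nonneg by simp
      ultimately show ?thesis using W by simp
    next
      case False
      then have "{..<p} \<union> (K i \<inter> {..<Suc m}) = S"
        by (auto simp: S_def less_Suc_eq)
      then show ?thesis using c_nonneg B0 by simp
    qed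
    also have "\<dots> \<le> V {..<p} + c * (real (Suc m - p) * (real \<tau> * B))"
      using IH step by (simp add: Suc_diff_le algebra_simps)
    finally show ?case .
  qed
  have "{..<p} \<union> (K i \<inter> {..<i}) = K i"
    using K_lower[of i] K_upper[of i] by (auto simp: p_def)
  then have "V (K i) \<le> V {..<p} + c * (real (i - p) * (real \<tau> * B))"
    using step[of i] by (simp add: p_def)
  also have "\<dots> \<le> V {..<p} + c * (real \<tau> * (real \<tau> * B))"
    using c_nonneg B0 by (intro add_left_mono mult_left_mono mult_right_mono) (auto simp: p_def)
  \<comment> \<open>The induction closes because 4/3 solves \<open>C = 1 + C / 4\<close>.\<close>
  also have "c * (real \<tau> * (real \<tau> * B)) = \<psi> * (4 / 3 * V {..<p})"
    by (simp add: c_def B_def \<psi>_def power2_eq_square power3_eq_cube mult_ac)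
  also have "\<dots> \<le> 1 / 4 * (4 / 3 * V {..<p})"
    using assms(1) V_nonneg by (intro mult_right_mono) auto
  finally show ?case by (simp add: p_def)
qed

text \<open>The weight \<open>\<tau> (\<tau> + 1) / 2\<close> of the window sum leaves room for the factor \<open>4 / 3\<close> as soon as
  \<open>\<tau> \<ge> 2\<close>; for \<open>\<tau> \<le> 1\<close> every \<^term>\<open>K i\<close> is a prefix and no factor is lost.\<close>

lemma stale_term_le:
  assumes "\<psi> \<le> 1 / 4" "s \<le> N"
  obtains B where "0 \<le> B" "\<And>i. i < s \<Longrightarrow> s \<le> i + \<tau> \<Longrightarrow> G i \<le> B"
    "c * (real \<tau> * (real \<tau> + 1) / 2 * B) \<le> \<psi> * V {..<s}"
proof -
  \<comment> \<open>\<open>C\<close> is the loss from a read that is not a prefix: 1 if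
    \<open>\<tau> \<le> 1\<close>, else 4/3.\<close>
  obtain C :: real where C: "0 \<le> C" "C * (real \<tau> * (real \<tau> + 1) / 2) \<le> (real \<tau>)\<^sup>2"
    and VK: "\<And>i. i < s \<Longrightarrow> s \<le> i + \<tau> \<Longrightarrow> V (K i) \<le> C * (V {..<s} / q ^ (2 * \<tau>))"
  proof (cases "\<tau> \<le> 1")
    case True
    have "V (K i) \<le> 1 * (V {..<s} / q ^ (2 * \<tau>))" if i: "i < s" "s \<le> i + \<tau>" for i
    proof -
      obtain k where k: "K i = {..<k}" "i - \<tau> \<le> k" "k \<le> i"
      proof (cases "K i = {..<i}")
        case False
        have "{..<i - \<tau>} \<subseteq> K i" using K_lower[of i] by auto
        \<comment> \<open>Only index \<open>i - 1\<close> can be missing from the read.\<close>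
        moreover have "{..<i} \<subseteq> insert (i - 1) {..<i - \<tau>}" using True by auto
        ultimately have "K i = {..<i - \<tau>}"
          using False K_upper[of i] by blast
        then show ?thesis by (intro that[of "i - \<tau>"]) auto
      qed (auto intro: that)
      then show ?thesis
        using i assms V_lessThan_le_later[of k s "2 * \<tau>"] by simp
    qed
    moreover have "1 * (real \<tau> * (real \<tau> + 1) / 2) \<le> (real \<tau>)\<^sup>2"
      using True by (auto simp: le_Suc_eq)
    ultimately show ?thesis by (intro that[of 1]) auto
  next
    case False
    have "V (K i) \<le> 4 / 3 * (V {..<s} / q ^ (2 * \<tau>))" if i: "i < s" "s \<le> i + \<tau>" for i
      using V_K_le[OF assms(1), of i] V_lessThan_le_later[of "i - \<tau>" s "2 * \<tau>"] i assms(2) by force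
    \<comment> \<open>This is where \<open>\<tau> \<ge> 2\<close> enters, as
      \<open>2 * (\<tau> + 1) \<le> 3 * \<tau>\<close>.\<close>
    moreover have "real \<tau> * (2 * (real \<tau> + 1)) \<le> real \<tau> * (3 * real \<tau>)"
      using False by (intro mult_left_mono) auto
    ultimately show ?thesis
      by (intro that[of "4 / 3"]) (auto simp: power2_eq_square algebra_simps)
  qed
  define B where "B = lambda_max A / real CARD('n) * (C * (V {..<s} / q ^ (2 * \<tau>)))"
  show ?thesis
  proof (rule that)
    show "0 \<le> B"
      unfolding B_def using lambda_max_pos q_bounds V_nonneg C by simp
    show "G i \<le> B" if "i < s" "s \<le> i + \<tau>" for i
    proof -
      have "G i \<le> lambda_max A / real CARD('n) * V (K i)"
        using that assms by (intro G_le) simp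
      also have "\<dots> \<le> B"
        unfolding B_def using that lambda_max_pos by (intro mult_left_mono VK) auto
      finally show ?thesis .
    qed
    define R where "R = \<beta>\<^sup>2 * real \<tau> * rho2 A * (lambda_max A / real CARD('n)) * (V {..<s} / q ^ (2 * \<tau>))"
    have "0 \<le> R"
      unfolding R_def using rho2_nonneg lambda_max_pos q_bounds V_nonneg by simp
    have "c * (real \<tau> * (real \<tau> + 1) / 2 * B) = R * (C * (real \<tau> * (real \<tau> + 1) / 2))"
      by (simp add: c_def B_def R_def mult_ac)
    also have "\<dots> \<le> R * (real \<tau>)\<^sup>2"
      by (intro mult_left_mono C) fact
    also have "\<dots> = \<psi> * V {..<s}"
      by (simp add: R_def \<psi>_def power2_eq_square power3_eq_cube mult_ac)
    finally show "c * (real \<tau> * (real \<tau> + 1) / 2 * B) \<le> \<psi> * V {..<s}" .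
  qed
qed

section \<open>Contraction over one epoch and its iteration\<close>

lemma power_q_le_half:
  assumes "ln (1 / 2) / ln q \<le> real k"
  shows "q ^ k \<le> 1 / 2"
proof -
  have "ln q < 0" using q_bounds by simp
  then have "real k * ln q \<le> ln (1 / 2)"
    using assms by (simp add: neg_divide_le_eq)
  then have "ln (q ^ k) \<le> ln (1 / 2)"
    using q_bounds by (simp add: ln_realpow)
  then show ?thesis using q_bounds by (subst (asm) ln_le_cancel_iff) auto
qed

lemma first_epoch:
  assumes "0 \<le> \<omega>" "m \<le> N" "q ^ m \<le> 1 / 2"
  shows "V {..<m} \<le> (1 - \<omega> / (2 * cond_num A)) * V {..<0}"
proof -
  have "V {..<m} \<le> V {..<0} - \<omega> * (\<Sum>j\<in>{0..<m}. G j)"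
    \<comment> \<open>No step precedes time 0, so the boundary bound can be 0.\<close>
    using V_lessThan_descent[of 0 m 0] assms by simp
  also have "\<dots> \<le> V {..<0} - \<omega> * (q ^ (0 - 0) / (2 * cond_num A) * V {..<0})"
    using assms by (intro diff_left_mono mult_left_mono G_sum_ge[where a = 0]) auto
  finally show ?thesis by (simp add: algebra_simps)
qed

text \<open>The first \<open>\<tau>\<close> steps let the reads catch up with time \<open>s\<close>,
  at the price of the factor \<open>q ^ \<tau>\<close>; the other \<open>k\<close> supply the
  halving.\<close>

lemma later_epoch:
  assumes "0 \<le> \<omega>" "\<psi> \<le> 1 / 4" "q ^ k \<le> 1 / 2" "s + (k + \<tau>) \<le> N"
  shows "V {..<s + (k + \<tau>)} \<le> (1 - \<omega> * q ^ \<tau> / (2 * cond_num A) + \<psi>) * V {..<s}"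
proof -
  obtain B where B: "0 \<le> B" "\<And>i. i < s \<Longrightarrow> s \<le> i + \<tau> \<Longrightarrow> G i \<le> B"
    "c * (real \<tau> * (real \<tau> + 1) / 2 * B) \<le> \<psi> * V {..<s}"
    using stale_term_le[OF assms(2), of s] assms(4) by auto
  have "q ^ (s + \<tau> - s) / (2 * cond_num A) * V {..<s} \<le> (\<Sum>j\<in>{s..<s + (k + \<tau>)}. G j)"
  proof (rule G_sum_ge)
    show "{..<s} \<subseteq> K j" if "s + \<tau> \<le> j" for j
      using K_lower[of j] that by auto
  qed (use assms in \<open>auto simp: add.commute\<close>)
  then have "\<omega> * (q ^ \<tau> / (2 * cond_num A) * V {..<s}) \<le> \<omega> * (\<Sum>j\<in>{s..<s + (k + \<tau>)}. G j)"
    using assms(1) by (intro mult_left_mono) auto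
  moreover have "V {..<s + (k + \<tau>)}
      \<le> V {..<s} - \<omega> * (\<Sum>j\<in>{s..<s + (k + \<tau>)}. G j) + c * (real \<tau> * (real \<tau> + 1) / 2 * B)"
    using B assms(4) by (intro V_lessThan_descent) auto
  ultimately have "V {..<s + (k + \<tau>)}
      \<le> V {..<s} - \<omega> * (q ^ \<tau> / (2 * cond_num A) * V {..<s}) + \<psi> * V {..<s}"
    using B(3) by linarith
  then show ?thesis by (simp add: algebra_simps)
qed

text \<open>Since \<open>2 * \<beta> * (1 - \<beta>)\<close> is at most 1/2. This keeps the
  contraction factors nonnegative and yields \<open>\<psi> \<le> 1 / 4\<close> when the later factor
  is below 1.\<close>

lemma omega_half_le: "0 \<le> \<omega> \<Longrightarrow> \<omega> / (2 * cond_num A) \<le> 1 / 4"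
proof -
  assume "0 \<le> \<omega>"
  have "0 \<le> (\<beta> - 1 / 2)\<^sup>2" by simp
  then have "2 * \<beta> * (1 - \<beta>) \<le> 1 / 2"
    by (simp add: power2_eq_square algebra_simps)
  moreover have "0 \<le> c * real \<tau>" using c_nonneg by simp
  ultimately have "\<omega> \<le> 1 / 2" unfolding omega_eq by linarith
  also have "\<dots> \<le> 1 / 2 * cond_num A"
    using cond_num_ge_1 by simp
  finally show ?thesis using cond_num_ge_1 by (simp add: field_simps)
qed

lemma epochs:
  assumes "0 \<le> \<omega>" "q ^ k \<le> 1 / 2" "Suc r * (k + \<tau>) \<le> m" "m \<le> N"
  shows "V {..<m} \<le> (1 - \<omega> / (2 * cond_num A))
    * (1 - \<omega> * q ^ \<tau> / (2 * cond_num A) + \<psi>) ^ r * V {..<0}"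
proof -
  define F where "F = 1 - \<omega> * q ^ \<tau> / (2 * cond_num A) + \<psi>"
  have first: "V {..<j} \<le> (1 - \<omega> / (2 * cond_num A)) * V {..<0}" if "k \<le> j" "j \<le> N" for j
  proof (rule first_epoch)
    have "q ^ j \<le> q ^ k" using q_bounds that by (intro power_decreasing) auto
    then show "q ^ j \<le> 1 / 2" using assms(2) by simp
  qed (use assms that in auto)
  have "q ^ \<tau> \<le> 1" using q_bounds by (simp add: power_le_one)
  then have small: "\<omega> * q ^ \<tau> / (2 * cond_num A) \<le> 1 / 4"
    using divide_right_mono[OF mult_left_le[OF _ assms(1)], of "q ^ \<tau>" "2 * cond_num A"]
      omega_half_le[OF assms(1)] cond_num_ge_1 by linarith
  have psi0: "0 \<le> \<psi>"
    unfolding \<psi>_def using rho2_nonneg lambda_max_pos q_bounds by simp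
  have F0: "0 \<le> F" unfolding F_def using small psi0 by linarith
  have "V {..<m} \<le> (1 - \<omega> / (2 * cond_num A)) * F ^ r * V {..<0}"
  \<comment> \<open>If \<open>F \<ge> 1\<close>, its powers only weaken the first-epoch bound;
    otherwise \<open>\<psi>\<close> is below the subtracted term, which is at most 1/4.\<close>
  proof (cases "1 \<le> F")
    case True
    have "0 \<le> (1 - \<omega> / (2 * cond_num A)) * V {..<0}"
      using omega_half_le[OF assms(1)] V_nonneg by simp
    moreover have "1 \<le> F ^ r" using True by simp
    ultimately have "(1 - \<omega> / (2 * cond_num A)) * V {..<0} * 1
        \<le> (1 - \<omega> / (2 * cond_num A)) * V {..<0} * F ^ r"
      by (intro mult_left_mono)
    moreover have "k \<le> m" using assms(3) by simp
    ultimately show ?thesis using first[of m] assms(4) by (simp add: mult_ac)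
  next
    case False
    then have psi: "\<psi> \<le> 1 / 4" using small unfolding F_def by linarith
    show ?thesis
      using assms(3,4)
    proof (induction r arbitrary: m)
      case 0
      then show ?case using first[of m] by simp
    next
      case (Suc r)
      \<comment> \<open>The last epoch is split off, so surplus steps end up in the first one, whose
        bound holds for every length from \<open>k\<close> on.\<close>
      define s where "s = m - (k + \<tau>)"
      have m: "m = s + (k + \<tau>)" using Suc.prems by (simp add: s_def)
      have "V {..<m} \<le> F * V {..<s}"
        unfolding m F_def using Suc.prems m assms psi by (intro later_epoch) auto
      also have "\<dots> \<le> F * ((1 - \<omega> / (2 * cond_num A)) * F ^ r * V {..<0})"
        using Suc.prems m F0 by (intro mult_left_mono Suc.IH) auto
      finally show ?case by (simp add: mult_ac)
    qed
  qed
  then show ?thesis by (simp add: F_def)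
qed

end

theorem theorem3:
  fixes A :: "real^'n^'n" and b x0 :: "real^'n" and \<beta> :: real and \<tau> :: nat
    and K :: "nat \<Rightarrow> nat set"
  assumes n2: "CARD('n) \<ge> 2"
    and sym: "transpose A = A"
    and posdef: "\<And>x. x \<noteq> 0 \<Longrightarrow> x \<bullet> (A *v x) > 0"
    and diag: "\<And>i. A $ i $ i = 1"
    and beta: "0 \<le> \<beta>" "\<beta> < 1"
    and K_lower: "\<And>j. {i. i + \<tau> + 1 \<le> j} \<subseteq> K j"
    and K_upper: "\<And>j. K j \<subseteq> {..<j}"
    and omega_pos: "2 * \<beta> * (1 - \<beta> - rho2 A * real \<tau>^2 * \<beta> / 2) > 0"
  shows
    "(\<forall>m::nat. real m \<ge> ln (1/2) / ln (1 - lambda_max A / real CARD('n)) \<longrightarrow>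
        err_exp A b x0 \<beta> K m
          \<le> (1 - 2 * \<beta> * (1 - \<beta> - rho2 A * real \<tau>^2 * \<beta> / 2) / (2 * cond_num A))
             * err_exp A b x0 \<beta> K 0)
     \<and>
     (let T0 = nat \<lceil>ln (1/2) / ln (1 - lambda_max A / real CARD('n))\<rceil>;
          T = T0 + \<tau>;
          \<omega> = 2 * \<beta> * (1 - \<beta> - rho2 A * real \<tau>^2 * \<beta> / 2);
          q = 1 - lambda_max A / real CARD('n);
          \<psi> = rho2 A * real \<tau>^3 * \<beta>^2 * lambda_max A * (1 / q^(2*\<tau>)) / real CARD('n)
      in \<forall>r m::nat. r \<ge> 1 \<longrightarrow> m \<ge> r * T \<longrightarrow>
           err_exp A b x0 \<beta> K m
             \<le> (1 - \<omega> / (2 * cond_num A))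
                * (1 - \<omega> * q^\<tau> / (2 * cond_num A) + \<psi>)^(r - 1)
                * err_exp A b x0 \<beta> K 0)"
proof -
  have it: "async_iteration A \<beta> \<tau> K"
    by unfold_locales (fact n2 sym posdef diag beta K_lower K_upper)+
  note eqs = async_iteration.err_exp_eq[OF it] and defs = async_iteration.\<omega>_def[OF it]
    async_iteration.q_def[OF it] async_iteration.\<psi>_def[OF it]
  have om: "0 \<le> async_iteration.\<omega> A \<beta> \<tau>"
    unfolding async_iteration.\<omega>_def[OF it] using omega_pos by simp
  show ?thesis
    unfolding Let_def
  proof (intro conjI allI impI)
    fix m :: nat
    assume "ln (1/2) / ln (1 - lambda_max A / real CARD('n)) \<le> real m"
    then have "async_iteration.q A ^ m \<le> 1 / 2"
      by (intro async_iteration.power_q_le_half[OF it]) (simp add: async_iteration.q_def[OF it])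
    \<comment> \<open>\<open>order_refl\<close> sets the horizon \<open>N\<close> to
      \<open>m\<close>.\<close>
    from async_iteration.first_epoch[OF it om order_refl this, of b x0]
    show "err_exp A b x0 \<beta> K m
        \<le> (1 - 2 * \<beta> * (1 - \<beta> - rho2 A * real \<tau>^2 * \<beta> / 2) / (2 * cond_num A))
           * err_exp A b x0 \<beta> K 0"
      by (simp add: eqs[where N = m] async_iteration.\<omega>_def[OF it])
  next
    fix r m :: nat
    define k where "k = nat \<lceil>ln (1/2) / ln (1 - lambda_max A / real CARD('n))\<rceil>"
    assume "1 \<le> r" "r * (nat \<lceil>ln (1/2) / ln (1 - lambda_max A / real CARD('n))\<rceil> + \<tau>) \<le> m"
    then have "Suc (r - 1) * (k + \<tau>) \<le> m" by (simp add: k_def)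
    moreover have "async_iteration.q A ^ k \<le> 1 / 2"
      by (intro async_iteration.power_q_le_half[OF it])
        (simp add: async_iteration.q_def[OF it] k_def real_nat_ceiling_ge)
    ultimately show "err_exp A b x0 \<beta> K m
        \<le> (1 - 2 * \<beta> * (1 - \<beta> - rho2 A * real \<tau>^2 * \<beta> / 2) / (2 * cond_num A))
          * (1 - 2 * \<beta> * (1 - \<beta> - rho2 A * real \<tau>^2 * \<beta> / 2)
                 * (1 - lambda_max A / real CARD('n))^\<tau> / (2 * cond_num A)
             + rho2 A * real \<tau>^3 * \<beta>^2 * lambda_max A
                 * (1 / (1 - lambda_max A / real CARD('n))^(2*\<tau>)) / real CARD('n))^(r - 1)
          * err_exp A b x0 \<beta> K 0"
      using async_iteration.epochs[OF it om _ _ order_refl, of k "r - 1" m b x0]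
      by (simp add: eqs[where N = m] defs)
  qed
qed

end
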